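(* Let $A\in\mathbb{R}^{n\times n}$, $B=[B_1\ \cdots\ B_m]\in\mathbb{R}^{n\times m}$ (columns $B_i$), $F\in\mathbb{R}^{n\times l}_+$, $E=[E_1^{\top}\ \cdots\ E_m^{\top}]^{\top}\in\mathbb{R}^{m\times n}_+$ (rows $E_i\neq 0$), $s\in\mathbb{R}^n$, $r\in\mathbb{R}^m$, $\gamma\in\mathbb{R}^l_+$, with $A-|B|E$ Metzler and $s\ge E^{\top}|r|$. Assume the following (equivalent) conditions hold: (i) the problem $\inf_{\mu}\sup_{w}\int_0^\infty[s^{\top}x+r^{\top}u-\gamma^{\top}w]\,d\tau$ subject to $\dot x=Ax+Bu+Fw$, $x(0)=x_0$, $u(t)=\mu(x(t))$, $|u|\le Ex$, $w\ge 0$, has a finite value for every $x_0\in\mathbb{R}^n_+$; (ii) there exists a unique vector in $\mathbb{R}^n_+$ which satisfies the relations $0=s+A^{\top}p-E^{\top}|r+B^{\top}p|$ and $\gamma\ge F^{\top}p$ and which is elementwise minimal among all solutions in $\mathbb{R}^n_+$ of these relations. Let $p\in\mathbb{R}^n_+$ be a solution of $$0=s+A^{\top}p-E^{\top}\left|r+B^{\top}p\right|$$ and let $K$ satisfy $$K\in\begin{bmatrix}\operatorname{sign}(r_1+p^{\top}B_1)E_1\\ \vdots\\ \operatorname{sign}(r_m+p^{\top}B_m)E_m\end{bmatrix}.$$ If $p>0$ and the spectral abscissa satisfies $\alpha(A-BK)\ne 0$, then the pair $(s^{\top}-r^{\top}K,\ A-BK)$ is detectable and $u(t)=-Kx(t)$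 is a stabilizing policy (i.e. $A-BK$ is Hurwitz). Moreover, if $\alpha(A-BK)=0$, then the pair $(s^{\top}-r^{\top}K,\ A-BK)$ is not detectable.
   Context: Inequalities between vectors or matrices are elementwise ($p>0$ means all entries are strictly positive), $|X|$ denotes the elementwise absolute value, and $\mathbb{R}^n_+$, $\mathbb{R}^{m\times n}_+$ denote vectors/matrices with nonnegative entries. A square matrix is Metzler if its off-diagonal entries are nonnegative, and Hurwitz if all its eigenvalues have strictly negative real part. The spectral abscissa $\alpha(X)$ is the greatest real part of the eigenvalues of $X$. The signum is set-valued: $\operatorname{sign}(y)=\{+1\}$ if $y>0$, $\{-1\}$ if $y<0$, and $[-1,1]$ if $y=0$; the inclusion for $K$ means that the $i$-th row of $K$ is $\sigma E_i$ for some $\sigma\in\operatorname{sign}(r_i+p^{\top}B_i)$. A pair $(C,M)$ (system $\dot x=Mx$, $y=Cx$) is detectable if all unobservable states are (asymptotically) stable. In the control problem, $\mu$ ranges over all (potentially nonlinear and time-varying) state-feedback policies producing $u(t)\in\mathbb{R}^m$ with $|u(t)|\le Ex(t)$, and $w$ ranges over all nonnegative disturbance functions of time with values in $\mathbb{R}^l$ for which the dynamics and cost are well defined. *)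

theory Defs
  imports "HOL-Analysis.Analysis"
begin

text \<open>
  On \<open>real^'n\<close> and \<open>real^'n^'m\<close> the library's \<open>\<le>\<close> and \<open>\<bar>_\<bar>\<close> are elementwise, so \<open>0 \<le> X\<close> says that
  all entries are nonnegative. The library's \<open><\<close> is \<open>\<le>\<close> and \<open>\<noteq>\<close>, hence strict elementwise
  positivity is always spelled out with a quantifier over the entries.
\<close>

section \<open>Matrices\<close>

definition Metzler :: "real^'n^'n \<Rightarrow> bool" where
  "Metzler M \<longleftrightarrow> (\<forall>i j. i \<noteq> j \<longrightarrow> 0 \<le> M $ i $ j)"

definition eigenvalues :: "real^'n^'n \<Rightarrow> complex set" where
  "eigenvalues M = {c. \<exists>v::complex^'n. v \<noteq> 0 \<and> map_matrix complex_of_real M *v v = c *s v}"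

definition Hurwitz :: "real^'n^'n \<Rightarrow> bool" where
  "Hurwitz M \<longleftrightarrow> (\<forall>c\<in>eigenvalues M. Re c < 0)"

text \<open>\<open>Max\<close> is a true maximum here: the set of eigenvalues is finite and nonempty.\<close>

definition spectral_abscissa :: "real^'n^'n \<Rightarrow> real" where
  "spectral_abscissa M = Max (Re ` eigenvalues M)"

definition set_sign :: "real \<Rightarrow> real set" where
  "set_sign y = (if y > 0 then {1} else if y < 0 then {-1} else {-1..1})"

section \<open>Detectability of \<open>x' = M x, y = C x\<close>\<close>

definition free_motion :: "real^'n^'n \<Rightarrow> real^'n \<Rightarrow> (real \<Rightarrow> real^'n) \<Rightarrow> bool" where
  "free_motion M x0 x \<longleftrightarrow>
     x 0 = x0 \<and> (\<forall>t\<ge>0. (x has_vector_derivative M *v x t) (at t within {0..}))"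

text \<open>
  There is exactly one free motion (on \<open>t \<ge> 0\<close>) from each state, so the choice between \<open>\<exists>\<close> and \<open>\<forall>\<close>
  in the next two definitions is immaterial.
\<close>

definition unobservable_state :: "real^'n^'q \<Rightarrow> real^'n^'n \<Rightarrow> real^'n \<Rightarrow> bool" where
  "unobservable_state C M x0 \<longleftrightarrow> (\<exists>x. free_motion M x0 x \<and> (\<forall>t\<ge>0. C *v x t = 0))"

definition stable_state :: "real^'n^'n \<Rightarrow> real^'n \<Rightarrow> bool" where
  "stable_state M x0 \<longleftrightarrow> (\<forall>x. free_motion M x0 x \<longrightarrow> (x \<longlongrightarrow> 0) at_top)"

definition detectable :: "real^'n^'q \<Rightarrow> real^'n^'n \<Rightarrow> bool" where
  "detectable C M \<longleftrightarrow> (\<forall>x0. unobservable_state C M x0 \<longrightarrow> stable_state M x0)"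

section \<open>The minimax problem\<close>

definition disturbances :: "(real \<Rightarrow> real^'l) set" where
  "disturbances = {w. (\<forall>t\<ge>0. 0 \<le> w t) \<and> (\<forall>T\<ge>0. w absolutely_integrable_on {0..T})}"

text \<open>
  Caratheodory solutions of \<open>x' = A x + B u + F w\<close>, \<open>x 0 = x0\<close>, under the time-varying state feedback
  \<open>u t = \<mu> t (x t)\<close>, written as an integral equation; at \<open>t = 0\<close> it gives the initial condition.
  No continuity is imposed on \<open>\<mu>\<close>.
\<close>

definition closed_loop ::
  "real^'n^'n \<Rightarrow> real^'m^'n \<Rightarrow> real^'l^'n \<Rightarrow> (real \<Rightarrow> real^'n \<Rightarrow> real^'m) \<Rightarrow> real^'n
    \<Rightarrow> (real \<Rightarrow> real^'l) \<Rightarrow> (real \<Rightarrow> real^'n) \<Rightarrow> bool" where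
  "closed_loop A B F \<mu> x0 w x \<longleftrightarrow>
     (\<forall>t\<ge>0. (\<lambda>\<tau>. \<mu> \<tau> (x \<tau>)) absolutely_integrable_on {0..t} \<and>
       ((\<lambda>\<tau>. A *v x \<tau> + B *v \<mu> \<tau> (x \<tau>) + F *v w \<tau>) has_integral (x t - x0)) {0..t})"

text \<open>
  The policies available from \<open>x0\<close>: those that produce, under every disturbance, a state trajectory
  defined for all times, and whose inputs always respect \<open>\<bar>u\<bar> \<le> E x\<close>. The existence requirement
  excludes ill-posed feedback laws, for which the supremum over disturbances would range over too few
  (or no) disturbances.
\<close>

definition policies ::
  "real^'n^'n \<Rightarrow> real^'m^'n \<Rightarrow> real^'l^'n \<Rightarrow> real^'n^'m \<Rightarrow> real^'n
    \<Rightarrow> (real \<Rightarrow> real^'n \<Rightarrow> real^'m) set" where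
  "policies A B F E x0 =
     {\<mu>. \<forall>w\<in>disturbances.
        (\<exists>x. closed_loop A B F \<mu> x0 w x) \<and>
        (\<forall>x. closed_loop A B F \<mu> x0 w x \<longrightarrow> (\<forall>t\<ge>0. \<bar>\<mu> t (x t)\<bar> \<le> E *v x t))}"

text \<open>
  \<open>J\<close> is the cost over the infinite horizon, an improper integral with values in the extended reals;
  if the limit does not exist then the cost is not defined, and no \<open>J\<close> satisfies the predicate.
\<close>

definition has_cost ::
  "real^'n \<Rightarrow> real^'m \<Rightarrow> real^'l \<Rightarrow> (real \<Rightarrow> real^'n \<Rightarrow> real^'m) \<Rightarrow> (real \<Rightarrow> real^'l)
    \<Rightarrow> (real \<Rightarrow> real^'n) \<Rightarrow> ereal \<Rightarrow> bool" where
  "has_cost s r \<gamma> \<mu> w x J \<longleftrightarrow>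
     ((\<lambda>T. ereal (integral {0..T} (\<lambda>\<tau>. s \<bullet> x \<tau> + r \<bullet> \<mu> \<tau> (x \<tau>) - \<gamma> \<bullet> w \<tau>))) \<longlongrightarrow> J) at_top"

definition minimax_value ::
  "real^'n^'n \<Rightarrow> real^'m^'n \<Rightarrow> real^'l^'n \<Rightarrow> real^'n^'m \<Rightarrow> real^'n \<Rightarrow> real^'m \<Rightarrow> real^'l
    \<Rightarrow> real^'n \<Rightarrow> ereal" where
  "minimax_value A B F E s r \<gamma> x0 =
     (INF \<mu>\<in>policies A B F E x0.
        Sup {J. \<exists>w\<in>disturbances. \<exists>x. closed_loop A B F \<mu> x0 w x \<and> has_cost s r \<gamma> \<mu> w x J})"

definition finite_minimax_value ::
  "real^'n^'n \<Rightarrow> real^'m^'n \<Rightarrow> real^'l^'n \<Rightarrow> real^'n^'m \<Rightarrow> real^'n \<Rightarrow> real^'m \<Rightarrow> real^'l \<Rightarrow> bool" where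
  "finite_minimax_value A B F E s r \<gamma> \<longleftrightarrow>
     (\<forall>x0. 0 \<le> x0 \<longrightarrow> \<bar>minimax_value A B F E s r \<gamma> x0\<bar> \<noteq> \<infinity>)"

section \<open>The algebraic equation\<close>

definition bellman_equation ::
  "real^'n^'n \<Rightarrow> real^'m^'n \<Rightarrow> real^'n^'m \<Rightarrow> real^'n \<Rightarrow> real^'m \<Rightarrow> real^'n \<Rightarrow> bool" where
  "bellman_equation A B E s r p \<longleftrightarrow>
     0 = s + transpose A *v p - transpose E *v \<bar>r + transpose B *v p\<bar>"

definition bellman_solutions ::
  "real^'n^'n \<Rightarrow> real^'m^'n \<Rightarrow> real^'l^'n \<Rightarrow> real^'n^'m \<Rightarrow> real^'n \<Rightarrow> real^'m \<Rightarrow> real^'l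
    \<Rightarrow> (real^'n) set" where
  "bellman_solutions A B F E s r \<gamma> =
     {p. 0 \<le> p \<and> bellman_equation A B E s r p \<and> transpose F *v p \<le> \<gamma>}"

definition unique_minimal_solution ::
  "real^'n^'n \<Rightarrow> real^'m^'n \<Rightarrow> real^'l^'n \<Rightarrow> real^'n^'m \<Rightarrow> real^'n \<Rightarrow> real^'m \<Rightarrow> real^'l \<Rightarrow> bool" where
  "unique_minimal_solution A B F E s r \<gamma> \<longleftrightarrow>
     (\<exists>!p. p \<in> bellman_solutions A B F E s r \<gamma> \<and> (\<forall>q\<in>bellman_solutions A B F E s r \<gamma>. p \<le> q))"

end

theory Submission
  imports Defs "HOL-Computational_Algebra.Fundamental_Theorem_Algebra"
begin

text \<open>
  Write \<open>M = A - B K\<close> and \<open>c = s - K\<^sup>T r\<close>. Since \<open>\<bar>K\<bar> \<le> E\<close>, the matrix \<open>M\<close> is Metzler and \<open>c \<ge> 0\<close>, and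
  the choice of signs in \<open>K\<close> turns the algebraic equation into \<open>M\<^sup>T p = - c\<close>. If \<open>p > 0\<close>, pairing an
  eigenvector's absolute value with \<open>p\<close> shows that no eigenvalue of \<open>M\<close> has positive real part; so
  \<open>\<alpha>(M) \<noteq> 0\<close> makes \<open>M\<close> Hurwitz, whence every motion is stable. If \<open>\<alpha>(M) = 0\<close>, Perron--Frobenius
  gives \<open>x \<noteq> 0\<close> with \<open>M x = 0\<close>; then \<open>c \<bullet> x = - p \<bullet> M x = 0\<close>, so the constant motion \<open>x\<close> is
  unobservable and does not tend to \<open>0\<close>.
\<close>


section \<open>Polynomials in a matrix\<close>

text \<open>This is \<open>f(N) v\<close> by Horner's scheme. Evaluating on vectors lets every
  algebraic rule follow by induction along \<open>pCons\<close>, without a ring structure on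
  matrices.\<close>

definition poly_act :: "complex poly \<Rightarrow> complex^'n^'n \<Rightarrow> complex^'n \<Rightarrow> complex^'n" where
  "poly_act f N v = fold_coeffs (\<lambda>a w. a *s v + N *v w) f 0"

lemma poly_act_0 [simp]: "poly_act 0 N v = 0"
  by (simp add: poly_act_def)

lemma poly_act_pCons [simp]: "poly_act (pCons a f) N v = a *s v + N *v poly_act f N v"
  by (cases "a = 0 \<and> f = 0") (auto simp: poly_act_def)

lemma poly_act_add: "poly_act (f + g) N v = poly_act f N v + poly_act g N v"
proof (induction f arbitrary: g)
  case (pCons a f)
  then show ?case
    by (cases g) (simp add: matrix_vector_right_distrib vector_sadd_rdistrib)
qed simp

lemma poly_act_smult: "poly_act (smult c f) N v = c *s poly_act f N v"
  by (induction f) (simp_all add: vector_smult_assoc vector_add_ldistrib vector_scalar_commute)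

lemma poly_act_scale: "poly_act f N (c *s v) = c *s poly_act f N v"
  by (induction f)
    (simp_all add: vector_smult_assoc vector_add_ldistrib vector_scalar_commute mult.commute)

lemma poly_act_diff: "poly_act f N (v - w) = poly_act f N v - poly_act f N w"
  by (induction f) (simp_all add: matrix_vector_mult_diff_distrib vector_sub_rdistrib vector_ssub_ldistrib)

lemma poly_act_commute: "poly_act f N (N *v v) = N *v poly_act f N v"
  by (induction f) (simp_all add: matrix_vector_right_distrib vector_scalar_commute)

lemma poly_act_linear_factor:
  "poly_act ([:-c, 1:] * f) N v = N *v poly_act f N v - c *s poly_act f N v"
proof -
  have *: "[:-c, 1:] * f = pCons 0 f + smult (-c) f"
    by simp
  show ?thesis
    unfolding * poly_act_add poly_act_smult by (simp add: vec_eq_iff)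
qed

text \<open>Since \<open>N\<close> commutes with \<open>f(N)\<close>, the factor
  \<open>N - c\<close> may act first instead of last. Acting last suits injectivity arguments;
  acting first peels a factor off a motion.\<close>

lemma poly_act_linear_factor':
  "poly_act ([:-c, 1:] * f) N v = poly_act f N (N *v v - c *s v)"
  unfolding poly_act_linear_factor by (simp add: poly_act_diff poly_act_scale poly_act_commute)

lemma poly_act_eigenvector: "N *v v = c *s v \<Longrightarrow> poly_act f N v = poly f c *s v"
  by (induction f)
    (simp_all add: vector_scalar_commute vector_smult_assoc vector_sadd_rdistrib mult.commute)

lemma poly_act_monom: "poly_act (monom a k) N v = a *s ((*v) N ^^ k) v"
  by (induction k) (simp_all add: monom_0 monom_Suc vector_scalar_commute)

lemma poly_act_sum: "poly_act (\<Sum>k\<in>I. f k) N v = (\<Sum>k\<in>I. poly_act (f k) N v)"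
  by (induction I rule: infinite_finite_induct) (simp_all add: poly_act_add)

text \<open>More vectors than the dimension are dependent. Dependence is a property of sets, so a
  family with repetitions needs a case of its own.\<close>

lemma ex_linear_relation:
  fixes x :: "nat \<Rightarrow> 'a::euclidean_space"
  obtains d u where "\<exists>k\<le>d. u k \<noteq> 0" "(\<Sum>k\<le>d. u k *\<^sub>R x k) = 0"
proof (cases "inj_on x {..DIM('a)}")
  case True
  have "dependent (x ` {..DIM('a)})"
    by (rule dependent_biggerset) (simp add: card_image True)
  then obtain u where u: "\<exists>v\<in>x ` {..DIM('a)}. u v \<noteq> 0" "(\<Sum>v\<in>x ` {..DIM('a)}. u v *\<^sub>R v) = 0"
    by (auto simp: dependent_finite)
  then show ?thesis
    using that[of "DIM('a)" "u \<circ> x"] by (auto simp: sum.reindex[OF True])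
next
  case False
  then obtain i j where ij: "i \<noteq> j" "i \<le> DIM('a)" "j \<le> DIM('a)" "x i = x j"
    by (auto simp: inj_on_def)
  \<comment> \<open>A repeated vector gives the relation \<open>x i - x j = 0\<close>.\<close>
  define u :: "nat \<Rightarrow> real" where "u k = (if k = i then 1 else 0) - (if k = j then 1 else 0)" for k
  have "(\<Sum>k\<le>DIM('a). u k *\<^sub>R x k) =
      (\<Sum>k\<le>DIM('a). if k = i then x k else 0) - (\<Sum>k\<le>DIM('a). if k = j then x k else 0)"
    unfolding sum_subtractf[symmetric] by (rule sum.cong) (auto simp: u_def)
  also have "\<dots> = 0"
    using ij by simp
  finally have "(\<Sum>k\<le>DIM('a). u k *\<^sub>R x k) = 0" .
  moreover have "u i \<noteq> 0"
    using ij(1) by (simp add: u_def)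
  ultimately show ?thesis
    using that ij(2) by blast
qed

lemma matrix_vector_mult_sum_left: "(\<Sum>k\<in>I. X k) *v v = (\<Sum>k\<in>I. X k *v v)"
  by (induction I rule: infinite_finite_induct) (simp_all add: matrix_vector_mult_add_rdistrib)

text \<open>The powers of \<open>N\<close> lie in a finite-dimensional real space, so some
  nontrivial combination of them vanishes; its coefficients form \<open>f\<close>. This weak form of
  Cayley-Hamilton suffices, since only \<open>f \<noteq> 0\<close> matters and not the
  degree.\<close>

lemma ex_annihilating_poly:
  fixes N :: "complex^'n^'n"
  obtains f where "f \<noteq> 0" "\<And>v. poly_act f N v = 0"
proof -
  define P where "P k = ((**) N ^^ k) (mat 1)" for k
  have P: "P k *v v = ((*v) N ^^ k) v" for k v
    by (induction k) (simp_all add: P_def flip: matrix_vector_mul_assoc)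
  obtain d u where u: "\<exists>k\<le>d. u k \<noteq> 0" "(\<Sum>k\<le>d. u k *\<^sub>R P k) = 0"
    by (rule ex_linear_relation)
  define f where "f = (\<Sum>k\<le>d. monom (complex_of_real (u k)) k)"
  have "coeff f k = u k" if "k \<le> d" for k
    using that by (simp add: f_def coeff_sum)
  then have "f \<noteq> 0"
    using u(1) by (metis coeff_0 of_real_eq_0_iff)
  moreover have "poly_act f N v = 0" for v
  proof -
    have "complex_of_real c *s w = c *\<^sub>R w" for c :: real and w :: "complex^'n"
      by (simp add: vec_eq_iff scaleR_conv_of_real[where 'a = complex])
    moreover have "(c *\<^sub>R X) *v v = c *\<^sub>R (X *v v)" for c and X :: "complex^'n^'n"
      by (simp add: vec_eq_iff matrix_vector_mult_def scaleR_sum_right)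
    ultimately have "poly_act f N v = (\<Sum>k\<le>d. u k *\<^sub>R P k) *v v"
      by (simp add: f_def poly_act_sum poly_act_monom matrix_vector_mult_sum_left P)
    then show ?thesis
      by (simp add: u(2))
  qed
  ultimately show ?thesis
    by (rule that)
qed

section \<open>Eigenvalues\<close>

abbreviation complexify :: "real^'n^'m \<Rightarrow> complex^'n^'m" where
  "complexify \<equiv> map_matrix complex_of_real"

text \<open>On an eigenvector for \<open>c\<close>, \<open>f(N)\<close> is multiplication by
  \<open>f(c)\<close>, so every eigenvalue is a root of an annihilating polynomial.\<close>

lemma finite_eigenvalues: "finite (eigenvalues M)"
proof -
  obtain f where f: "f \<noteq> 0" "\<And>v. poly_act f (complexify M) v = 0"
    using ex_annihilating_poly[of "complexify M"] by blast
  have "eigenvalues M \<subseteq> {c. poly f c = 0}"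
  proof
    fix c
    assume "c \<in> eigenvalues M"
    then obtain v where v: "v \<noteq> 0" "complexify M *v v = c *s v"
      by (auto simp: eigenvalues_def)
    have "poly f c *s v = 0"
      using f(2)[of v] poly_act_eigenvector[OF v(2)] by simp
    with v(1) show "c \<in> {c. poly f c = 0}"
      by simp
  qed
  then show ?thesis
    using poly_roots_finite[OF f(1)] finite_subset by blast
qed

text \<open>Injectivity of \<open>N - c\<close>, phrased for the expression that
  \<open>poly_act_linear_factor\<close> produces.\<close>

lemma not_eigenvalueD:
  assumes "c \<notin> eigenvalues M" "complexify M *v v - c *s v = 0"
  shows "v = 0"
  using assms by (auto simp: eigenvalues_def)

text \<open>By the fundamental theorem of algebra, a nonzero polynomial is built from a nonzero
  constant by linear factors. The induction serves to strip an annihilating polynomial factor by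
  factor.\<close>

lemma complex_poly_induct [consumes 1, case_names const factor]:
  fixes f :: "complex poly"
  assumes "f \<noteq> 0" and "\<And>a. a \<noteq> 0 \<Longrightarrow> P [:a:]"
    and "\<And>c g. P g \<Longrightarrow> P ([:-c, 1:] * g)"
  shows "P f"
  using assms(1)
proof (induction "degree f" arbitrary: f rule: less_induct)
  case less
  show ?case
  proof (cases "degree f = 0")
    case True
    then show ?thesis
      using assms(2) less.prems by (auto elim: degree_eq_zeroE)
  next
    case False
    then obtain c where "poly f c = 0"
      using alg_closed_imp_poly_has_root by blast
    then obtain g where g: "f = [:-c, 1:] * g"
      unfolding poly_eq_0_iff_dvd by (elim dvdE)
    with less.prems have "g \<noteq> 0"
      by auto
    with g have "degree g < degree f"
      by (simp add: degree_mult_eq del: mult_pCons_left)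
    with less.hyps \<open>g \<noteq> 0\<close> assms(3) show ?thesis
      unfolding g by blast
  qed
qed

text \<open>Without eigenvalues every factor \<open>N - c\<close> would be injective, hence so would
  \<open>f(N)\<close> for every nonzero \<open>f\<close>, contradicting the existence of an
  annihilating one.\<close>

lemma eigenvalues_nonempty:
  fixes M :: "real^'n^'n"
  shows "eigenvalues M \<noteq> {}"
proof
  assume none: "eigenvalues M = {}"
  obtain f where f: "f \<noteq> 0" "\<And>v. poly_act f (complexify M) v = 0"
    using ex_annihilating_poly[of "complexify M"] by blast
  from f(1) have "\<forall>v. poly_act f (complexify M) v = 0 \<longrightarrow> v = 0"
  proof (induction f rule: complex_poly_induct)
    case (factor c g)
    then show ?case
      using none not_eigenvalueD[of c M]
      by (simp add: poly_act_linear_factor del: mult_pCons_left)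
  qed simp
  \<comment> \<open>Here \<open>1\<close> is the all-ones vector, a convenient nonzero
    vector.\<close>
  with f(2) have "(1::complex^'n) = 0"
    by blast
  then show False
    by simp
qed

lemma spectral_abscissa_eigenvalue:
  obtains c where "c \<in> eigenvalues M" "Re c = spectral_abscissa M"
proof -
  have "spectral_abscissa M \<in> Re ` eigenvalues M"
    unfolding spectral_abscissa_def
    by (rule Max_in) (simp_all add: finite_eigenvalues eigenvalues_nonempty)
  then show ?thesis
    using that by auto
qed

lemma Re_eigenvalue_le: "c \<in> eigenvalues M \<Longrightarrow> Re c \<le> spectral_abscissa M"
  by (simp add: spectral_abscissa_def finite_eigenvalues)

section \<open>Hurwitz matrices generate stable motions\<close>

text \<open>An integrating factor removes the term \<open>c * y\<close>. After a time
  \<open>T\<close> the small forcing contributes at most \<open>e / 2\<close>, while the influence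
  of \<open>y T\<close> dies out exponentially.\<close>

lemma scalar_forced_decay:
  fixes y w :: "real \<Rightarrow> complex"
  assumes c: "Re c < 0" and w: "(w \<longlongrightarrow> 0) at_top"
    and y: "\<And>t. t > 0 \<Longrightarrow> (y has_vector_derivative c * y t + w t) (at t)"
  shows "(y \<longlongrightarrow> 0) at_top"
proof (rule tendstoI)
  fix e :: real
  assume "e > 0"
  define a where "a = - Re c"
  define u where "u t = exp (- c * of_real t) * y t" for t
  have a: "a > 0"
    using c by (simp add: a_def)
  have norm_exp: "norm (exp (- c * of_real t)) = exp (a * t)" for t
    by (simp add: norm_exp_eq_Re a_def)
  have u': "(u has_vector_derivative exp (- c * of_real t) * w t) (at t)" if "t > 0" for t
  proof -
    have "((\<lambda>t. exp (- c * of_real t)) has_vector_derivative - c * exp (- c * of_real t)) (at t)"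
      by (rule has_vector_derivative_real_field) (auto intro!: derivative_eq_intros)
    from has_vector_derivative_mult[OF this y[OF that]] show ?thesis
      by (simp add: u_def[abs_def] algebra_simps)
  qed
  \<comment> \<open>The threshold is chosen so that the resulting bound on the derivative of
    \<open>u\<close>, \<open>exp (a * t) * (a * e / 2)\<close>, has the antiderivative
    \<open>e / 2 * exp (a * t)\<close>.\<close>
  have "\<forall>\<^sub>F t in at_top. norm (w t) < a * e / 2"
    using tendstoD[OF w, of "a * e / 2"] a \<open>e > 0\<close> by simp
  then have "\<forall>\<^sub>F T in at_top. T > 0 \<and> (\<forall>t\<ge>T. norm (w t) < a * e / 2)"
    by (intro eventually_conj eventually_gt_at_top eventually_all_ge_at_top)
  then obtain T where T: "T > 0" "\<And>t. t \<ge> T \<Longrightarrow> norm (w t) < a * e / 2"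
    using eventually_happens' trivial_limit_at_top_linorder by (metis (no_types, lifting))
  have bound: "norm (y t) \<le> exp (- (a * (t - T))) * norm (y T) + e / 2" if "t > T" for t
  proof -
    have "norm (u t - u T) \<le> e / 2 * exp (a * t) - e / 2 * exp (a * T)"
    proof (rule differentiable_bound_general[OF that])
      show "continuous_on {T..t} u"
        using T(1) by (auto intro!: continuous_at_imp_continuous_on has_vector_derivative_continuous[OF u'])
      show "continuous_on {T..t} (\<lambda>t. e / 2 * exp (a * t))"
        by (intro continuous_intros)
      show "(u has_vector_derivative exp (- c * of_real x) * w x) (at x)" if "T < x" for x
        using u' that T(1) by simp
      show "((\<lambda>t. e / 2 * exp (a * t)) has_vector_derivative exp (a * x) * (a * e / 2)) (at x)" for x
        by (auto intro!: derivative_eq_intros simp: has_real_derivative_iff_has_vector_derivative[symmetric])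
      show "norm (exp (- c * of_real x) * w x) \<le> exp (a * x) * (a * e / 2)" if "T < x" for x
        unfolding norm_mult norm_exp using T(2)[of x] that by (intro mult_left_mono) auto
    qed
    also have "\<dots> \<le> e / 2 * exp (a * t)"
      using \<open>e > 0\<close> by simp
    finally have "norm (u t) \<le> norm (u T) + e / 2 * exp (a * t)"
      using norm_triangle_ineq2[of "u t" "u T"] by linarith
    then have "exp (a * t) * norm (y t) \<le> exp (a * T) * norm (y T) + e / 2 * exp (a * t)"
      by (simp only: u_def norm_mult norm_exp)
    also have "\<dots> = exp (a * t) * (exp (- (a * (t - T))) * norm (y T) + e / 2)"
      by (simp add: algebra_simps flip: exp_add)
    finally show ?thesis
      by simp
  qed
  have "filterlim (\<lambda>t. a * (t - T)) at_top at_top"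
    using a filterlim_tendsto_add_at_top[OF tendsto_const filterlim_ident, of "- T"]
    by (intro filterlim_tendsto_pos_mult_at_top[OF tendsto_const]) simp_all
  then have "((\<lambda>t. exp (- (a * (t - T))) * norm (y T)) \<longlongrightarrow> 0) at_top"
    by (intro tendsto_mult_left_zero filterlim_compose[OF exp_at_bot]) (simp add: filterlim_uminus_at_bot)
  then have "\<forall>\<^sub>F t in at_top. exp (- (a * (t - T))) * norm (y T) < e / 2"
    using \<open>e > 0\<close> by (intro order_tendstoD) auto
  with eventually_gt_at_top[of T] show "\<forall>\<^sub>F t in at_top. dist (y t) 0 < e"
  proof eventually_elim
    case (elim t)
    with bound[of t] show ?case
      by simp
  qed
qed

text \<open>Induction on the linear factors of \<open>f\<close>, in place of a Jordan form. If
  \<open>c\<close> is an eigenvalue, \<open>w = (N - c) y\<close> is again a motion, annihilated by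
  the remaining factor \<open>g\<close>; so \<open>w\<close> tends to \<open>0\<close> and each
  entry of \<open>y\<close> solves \<open>y' = c y + w\<close> with \<open>Re c < 0\<close>.
  Otherwise \<open>N - c\<close> is injective and \<open>g\<close> already annihilates
  \<open>y\<close>.\<close>

lemma motion_tendsto_0_of_poly_act:
  fixes M :: "real^'n^'n" and y :: "real \<Rightarrow> complex^'n"
  assumes "Hurwitz M" and "f \<noteq> 0"
    and "\<And>t. t > 0 \<Longrightarrow> (y has_vector_derivative complexify M *v y t) (at t)"
    and "\<And>t. t > 0 \<Longrightarrow> poly_act f (complexify M) (y t) = 0"
  shows "(y \<longlongrightarrow> 0) at_top"
  using assms(2-)
proof (induction f arbitrary: y rule: complex_poly_induct)
  case (const a)
  have "\<forall>\<^sub>F t in at_top. y t = 0"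
    using eventually_gt_at_top[of 0] by eventually_elim (use const in simp)
  then show ?case
    by (rule tendsto_eventually)
next
  case (factor c g)
  let ?N = "complexify M"
  show ?case
  proof (cases "c \<in> eigenvalues M")
    case True
    define w where "w t = ?N *v y t - c *s y t" for t
    have lin: "bounded_linear (\<lambda>v. ?N *v v - c *s v)"
      unfolding linear_conv_bounded_linear[symmetric]
      by (rule linearI) (simp_all add: vec_eq_iff matrix_vector_mult_def algebra_simps
          scaleR_sum_right sum.distrib)
    have "(w \<longlongrightarrow> 0) at_top"
    proof (rule factor.IH)
      fix t :: real
      assume "t > 0"
      show "(w has_vector_derivative ?N *v w t) (at t)"
        using bounded_linear.has_vector_derivative[OF lin factor.prems(1)[OF \<open>t > 0\<close>]]
        by (simp add: w_def[abs_def] matrix_vector_mult_diff_distrib vector_scalar_commute)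
      show "poly_act g ?N (w t) = 0"
        using factor.prems(2)[OF \<open>t > 0\<close>] by (simp only: w_def poly_act_linear_factor')
    qed
    then have w: "((\<lambda>t. w t $ i) \<longlongrightarrow> 0) at_top" for i
      using tendsto_vec_nth by fastforce
    have "((\<lambda>t. y t $ i) \<longlongrightarrow> 0) at_top" for i
    proof (rule scalar_forced_decay[OF _ w])
      show "Re c < 0"
        using True assms(1) by (simp add: Hurwitz_def)
      show "((\<lambda>t. y t $ i) has_vector_derivative c * y t $ i + w t $ i) (at t)" if "t > 0" for t
        using bounded_linear.has_vector_derivative[OF bounded_linear_vec_nth factor.prems(1)[OF that]]
        by (simp add: w_def)
    qed
    then show ?thesis
      by (intro vec_tendstoI) simp
  next
    case False
    show ?thesis
    proof (rule factor.IH)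
      show "(y has_vector_derivative ?N *v y t) (at t)" if "t > 0" for t
        using factor.prems(1) that by blast
      show "poly_act g ?N (y t) = 0" if "t > 0" for t
        using factor.prems(2)[OF that] unfolding poly_act_linear_factor
        by (rule not_eigenvalueD[OF False])
    qed
  qed
qed

lemma Hurwitz_imp_stable_state:
  fixes M :: "real^'n^'n"
  assumes "Hurwitz M"
  shows "stable_state M x0"
  unfolding stable_state_def
proof (intro allI impI)
  fix x
  assume x: "free_motion M x0 x"
  define y :: "real \<Rightarrow> complex^'n" where "y t = (\<chi> i. of_real (x t $ i))" for t
  obtain f where f: "f \<noteq> 0" "\<And>v. poly_act f (complexify M) v = 0"
    using ex_annihilating_poly[of "complexify M"] by blast
  have lin: "bounded_linear (\<lambda>v. \<chi> i. complex_of_real (v $ i) :: complex^'n)"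
    unfolding linear_conv_bounded_linear[symmetric]
    by (rule linearI) (simp_all add: vec_eq_iff scaleR_conv_of_real[where 'a = complex])
  have "(y \<longlongrightarrow> 0) at_top"
  proof (rule motion_tendsto_0_of_poly_act[OF assms f(1) _ f(2)])
    fix t :: real
    assume "t > 0"
    then have "(x has_vector_derivative M *v x t) (at t within {0..})"
      using x by (simp add: free_motion_def)
    \<comment> \<open>A positive time is interior to the half-line, so the one-sided derivative is
      two-sided there.\<close>
    then have "(x has_vector_derivative M *v x t) (at t)"
      using \<open>t > 0\<close> at_within_interior[of t "{0..}"] by (simp add: interior_real_atLeast)
    from bounded_linear.has_vector_derivative[OF lin this]
    show "(y has_vector_derivative complexify M *v y t) (at t)"
      by (simp add: y_def[abs_def] matrix_vector_mult_def)
  qed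
  then have "((\<lambda>t. Re (y t $ i)) \<longlongrightarrow> 0) at_top" for i
    using tendsto_Re[OF tendsto_vec_nth] by fastforce
  then show "(x \<longlongrightarrow> 0) at_top"
    by (intro vec_tendstoI) (simp add: y_def)
qed

section \<open>Metzler matrices\<close>

text \<open>Only diagonal entries can be negative, and \<open>k\<close> exceeds all their absolute
  values. The summand \<open>1\<close> keeps \<open>k\<close> positive even for a zero
  diagonal.\<close>

lemma Metzler_shift_nonneg:
  assumes "Metzler M"
  obtains k where "k > 0" "\<And>i j. 0 \<le> (M + mat k) $ i $ j"
proof -
  define k where "k = 1 + (\<Sum>i\<in>UNIV. \<bar>M $ i $ i\<bar>)"
  have "\<bar>M $ i $ i\<bar> \<le> k - 1" for i
    unfolding k_def using member_le_sum[of i UNIV "\<lambda>i. \<bar>M $ i $ i\<bar>"] by simp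
  then have "0 \<le> M $ i $ i + k" for i
    using abs_ge_minus_self[of "M $ i $ i"] by (smt (verit))
  then have "0 \<le> (M + mat k) $ i $ j" for i j
    using assms by (cases "i = j") (auto simp: Metzler_def mat_def)
  moreover have "k > 0"
    by (simp add: k_def add_pos_nonneg sum_nonneg)
  ultimately show ?thesis
    using that by blast
qed

lemma mat_mult_vector: "mat k *v x = k *s x"
  by (simp add: vec_eq_iff matrix_vector_mult_def mat_def mult_delta_left)

text \<open>The triangle inequality in each row of \<open>(M + k) v = (c + k) v\<close>; the
  nonnegative entries of \<open>M + k\<close> pass through the absolute value unchanged.\<close>

lemma nonneg_shift_eigenvector_abs:
  fixes M :: "real^'n^'n" and v :: "complex^'n"
  assumes nonneg: "\<And>i j. 0 \<le> (M + mat k) $ i $ j"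
    and v: "complexify M *v v = c *s v"
  shows "cmod (c + of_real k) *\<^sub>R (\<chi> i. cmod (v $ i)) \<le> (M + mat k) *v (\<chi> i. cmod (v $ i))"
  unfolding less_eq_vec_def
proof
  fix i
  have "complexify (M + mat k) = complexify M + mat (of_real k)"
    by (simp add: vec_eq_iff mat_def)
  then have "complexify (M + mat k) *v v = (c + of_real k) *s v"
    by (simp only: matrix_vector_mult_add_rdistrib mat_mult_vector v vector_sadd_rdistrib)
  then have "cmod (c + of_real k) * cmod (v $ i) = cmod ((complexify (M + mat k) *v v) $ i)"
    by (simp add: norm_mult flip: distrib_right)
  also have "\<dots> \<le> (\<Sum>j\<in>UNIV. cmod (of_real ((M + mat k) $ i $ j) * v $ j))"
    by (simp add: matrix_vector_mult_def) (rule norm_sum)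
  also have "\<dots> = ((M + mat k) *v (\<chi> i. cmod (v $ i))) $ i"
    using nonneg by (simp add: matrix_vector_mult_def norm_mult del: vector_add_component of_real_add)
  finally show "(cmod (c + of_real k) *\<^sub>R (\<chi> i. cmod (v $ i))) $ i
      \<le> ((M + mat k) *v (\<chi> i. cmod (v $ i))) $ i"
    by simp
qed

text \<open>For \<open>a\<close>, the entrywise modulus of an eigenvector, pairing with
  \<open>p\<close> gives \<open>cmod (c + k) * (p \<bullet> a) \<le> k * (p \<bullet> a)\<close>.
  Positivity of \<open>p\<close> allows division, and
  \<open>Re c + k \<le> cmod (c + k) \<le> k\<close>.\<close>

lemma Metzler_Re_eigenvalue_nonpos:
  fixes M :: "real^'n^'n"
  assumes "Metzler M" and p: "\<And>i. 0 < p $ i" and sub: "transpose M *v p \<le> 0"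
    and "c \<in> eigenvalues M"
  shows "Re c \<le> 0"
proof -
  obtain k where k: "k > 0" "\<And>i j. 0 \<le> (M + mat k) $ i $ j"
    using Metzler_shift_nonneg[OF assms(1)] by blast
  obtain v where v: "v \<noteq> 0" "complexify M *v v = c *s v"
    using assms(4) by (auto simp: eigenvalues_def)
  define a :: "real^'n" where "a = (\<chi> i. cmod (v $ i))"
  have inner_mono: "z \<bullet> x \<le> z \<bullet> y" if "x \<le> y" "\<And>i. 0 \<le> z $ i" for x y z :: "real^'n"
    using that by (auto simp: inner_vec_def less_eq_vec_def intro!: sum_mono mult_left_mono)
  have "0 < p \<bullet> a"
  proof -
    obtain i where "v $ i \<noteq> 0"
      using v(1) by (auto simp: vec_eq_iff)
    then show ?thesis
      unfolding inner_vec_def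
      by (intro sum_pos2[of _ i]) (auto simp: a_def p less_imp_le)
  qed
  have "cmod (c + of_real k) * (p \<bullet> a) = p \<bullet> (cmod (c + of_real k) *\<^sub>R a)"
    by simp
  also have "\<dots> \<le> p \<bullet> ((M + mat k) *v a)"
    using nonneg_shift_eigenvector_abs[OF k(2) v(2)] p
    by (intro inner_mono) (auto simp: a_def less_imp_le)
  \<comment> \<open>Moving \<open>M\<close> to the other side of the inner product exposes a term
    that is nonpositive, because \<open>a \<ge> 0\<close>.\<close>
  also have "\<dots> = a \<bullet> (transpose M *v p) + k * (p \<bullet> a)"
    by (simp add: matrix_vector_mult_add_rdistrib mat_mult_vector inner_add_right
        scalar_mult_eq_scaleR dot_lmul_matrix[symmetric] inner_commute)
  also have "\<dots> \<le> k * (p \<bullet> a)"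
    using inner_mono[OF sub, of a] by (simp add: a_def)
  finally have "cmod (c + of_real k) \<le> k"
    using \<open>0 < p \<bullet> a\<close> by simp
  then show ?thesis
    using complex_Re_le_cmod[of "c + of_real k"] by simp
qed

text \<open>Normalizing \<open>Q x\<close> to unit sum maps \<open>{x \<ge> 0. \<Sum>x = 1 \<and> k x \<le> Q x}\<close> to itself, and Brouwer's fixed
  point is an eigenvector.\<close>

lemma nonneg_matrix_ex_eigenvector:
  fixes Q :: "real^'n^'n"
  assumes Q: "\<And>i j. 0 \<le> Q $ i $ j" and "k > 0"
    and a: "0 \<le> a" "a \<noteq> 0" "k *\<^sub>R a \<le> Q *v a"
  obtains \<rho> x where "\<rho> \<ge> k" "x \<noteq> 0" "Q *v x = \<rho> *\<^sub>R x"
proof -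
  define \<sigma> where "\<sigma> x = (\<Sum>i\<in>UNIV. x $ i)" for x :: "real^'n"
  define S where "S = {x. 0 \<le> x \<and> \<sigma> x = 1 \<and> k *\<^sub>R x \<le> Q *v x}"
  have \<sigma>_scaleR: "\<sigma> (c *\<^sub>R x) = c * \<sigma> x" for c x
    by (simp add: \<sigma>_def sum_distrib_left)
  have \<sigma>_add: "\<sigma> (x + y) = \<sigma> x + \<sigma> y" for x y
    by (simp add: \<sigma>_def sum.distrib)
  have \<sigma>_mono: "\<sigma> x \<le> \<sigma> y" if "x \<le> y" for x y
    using that by (auto simp: \<sigma>_def less_eq_vec_def intro: sum_mono)
  have Q_mono: "Q *v x \<le> Q *v y" if "x \<le> y" for x y
    using that Q by (auto simp: less_eq_vec_def matrix_vector_mult_def intro!: sum_mono mult_left_mono)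
  have in_S: "(1 / \<sigma> x) *\<^sub>R x \<in> S" if "0 \<le> x" "\<sigma> x > 0" "k *\<^sub>R x \<le> Q *v x" for x
    using that by (auto simp: S_def \<sigma>_scaleR less_eq_vec_def matrix_vector_mult_scaleR
        divide_right_mono)
  \<comment> \<open>This lower bound keeps the denominator of \<open>h\<close> away from zero and
    later gives \<open>\<rho> \<ge> k\<close>.\<close>
  have \<sigma>_Q: "\<sigma> (Q *v x) \<ge> k" if "x \<in> S" for x
    using that \<sigma>_mono[of "k *\<^sub>R x" "Q *v x"] by (simp add: S_def \<sigma>_scaleR)
  define h where "h x = (1 / \<sigma> (Q *v x)) *\<^sub>R (Q *v x)" for x
  have cont: "continuous_on UNIV \<sigma>" "continuous_on UNIV ((*v) Q)"
    unfolding \<sigma>_def by (intro continuous_intros linear_continuous_on matrix_vector_mul_bounded_linear)+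
  have "compact S"
  proof -
    have "norm x \<le> 1" if "x \<in> S" for x
      using norm_le_l1_cart[of x] that by (simp add: S_def \<sigma>_def less_eq_vec_def)
    then have "bounded S"
      by (auto simp: bounded_iff)
    moreover have "closed S"
      unfolding S_def less_eq_vec_def
      by (intro closed_Collect_conj closed_Collect_all closed_Collect_le closed_Collect_eq
          continuous_intros cont)
    ultimately show ?thesis
      by (simp add: compact_eq_bounded_closed)
  qed
  moreover have "convex S"
  proof (rule convexI)
    fix x y and u v :: real
    assume "x \<in> S" "y \<in> S" "0 \<le> u" "0 \<le> v" "u + v = 1"
    then have "k *\<^sub>R (u *\<^sub>R x + v *\<^sub>R y) \<le> Q *v (u *\<^sub>R x + v *\<^sub>R y)"
      by (auto simp: S_def less_eq_vec_def matrix_vector_right_distrib matrix_vector_mult_scaleR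
          distrib_left mult.left_commute[of k] intro!: add_mono mult_left_mono)
    then show "u *\<^sub>R x + v *\<^sub>R y \<in> S"
      using \<open>x \<in> S\<close> \<open>y \<in> S\<close> \<open>0 \<le> u\<close> \<open>0 \<le> v\<close> \<open>u + v = 1\<close>
      by (auto simp: S_def less_eq_vec_def \<sigma>_add \<sigma>_scaleR)
  qed
  moreover have "S \<noteq> {}"
  proof -
    obtain i where "a $ i \<noteq> 0"
      using a(2) by (auto simp: vec_eq_iff)
    then have "\<sigma> a > 0"
      unfolding \<sigma>_def using a(1) by (intro sum_pos2[of _ i]) (auto simp: less_eq_vec_def less_le)
    with in_S[of a] a show ?thesis
      by blast
  qed
  moreover have "continuous_on S h"
  proof -
    have "continuous_on S ((*v) Q)"
      using cont(2) continuous_on_subset by blast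
    moreover have "continuous_on S (\<lambda>x. \<sigma> (Q *v x))"
      using continuous_on_compose2[OF cont] continuous_on_subset by blast
    ultimately show ?thesis
      unfolding h_def[abs_def] using \<sigma>_Q \<open>k > 0\<close> by (intro continuous_intros) fastforce+
  qed
  moreover have "h \<in> S \<rightarrow> S"
  proof
    fix x
    assume x: "x \<in> S"
    show "h x \<in> S"
      unfolding h_def
    proof (rule in_S)
      show "0 \<le> Q *v x"
        using Q_mono[of 0 x] x by (simp add: S_def)
      show "\<sigma> (Q *v x) > 0"
        using \<sigma>_Q[OF x] \<open>k > 0\<close> by simp
      \<comment> \<open>The constraint defining \<open>S\<close> is preserved because the monotone
        map \<open>Q\<close> may be applied to both of its sides.\<close>
      show "k *\<^sub>R (Q *v x) \<le> Q *v (Q *v x)"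
        using Q_mono[of "k *\<^sub>R x" "Q *v x"] x by (simp add: S_def matrix_vector_mult_scaleR)
    qed
  qed
  ultimately obtain x where x: "x \<in> S" "h x = x"
    by (rule brouwer)
  have "x \<noteq> 0"
    using x(1) by (auto simp: S_def \<sigma>_def)
  moreover have "Q *v x = \<sigma> (Q *v x) *\<^sub>R h x"
    using \<sigma>_Q[OF x(1)] \<open>k > 0\<close> by (simp add: h_def)
  ultimately show ?thesis
    using that \<sigma>_Q[OF x(1)] x(2) by metis
qed

text \<open>An eigenvalue \<open>c\<close> on the imaginary axis need not be \<open>0\<close>, but
  \<open>cmod (c + k) \<ge> k\<close> makes the modulus of its eigenvector a valid start for the
  Perron argument. This yields a real eigenvalue \<open>\<rho> - k \<ge> 0\<close> of
  \<open>M\<close>, and the spectral abscissa forces \<open>\<rho> = k\<close>.\<close>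

lemma Metzler_ex_kernel_vector:
  fixes M :: "real^'n^'n"
  assumes "Metzler M" "spectral_abscissa M = 0"
  obtains x where "x \<noteq> 0" "M *v x = 0"
proof -
  obtain k where k: "k > 0" "\<And>i j. 0 \<le> (M + mat k) $ i $ j"
    using Metzler_shift_nonneg[OF assms(1)] by blast
  obtain c where "c \<in> eigenvalues M" "Re c = 0"
    using spectral_abscissa_eigenvalue[of M] assms(2) by metis
  then obtain v where v: "v \<noteq> 0" "complexify M *v v = c *s v"
    by (auto simp: eigenvalues_def)
  define a :: "real^'n" where "a = (\<chi> i. cmod (v $ i))"
  have a: "0 \<le> a" "a \<noteq> 0"
    using v(1) by (auto simp: a_def vec_eq_iff less_eq_vec_def)
  have "k \<le> cmod (c + of_real k)"
    using complex_Re_le_cmod[of "c + of_real k"] \<open>Re c = 0\<close> by simp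
  then have "k *\<^sub>R a \<le> cmod (c + of_real k) *\<^sub>R a"
    using a(1) by (auto simp: less_eq_vec_def intro!: mult_right_mono)
  also have "\<dots> \<le> (M + mat k) *v a"
    unfolding a_def by (rule nonneg_shift_eigenvector_abs[OF k(2) v(2)])
  finally obtain \<rho> x where x: "\<rho> \<ge> k" "x \<noteq> 0" "(M + mat k) *v x = \<rho> *\<^sub>R x"
    using nonneg_matrix_ex_eigenvector[OF k(2,1) a] by blast
  then have Mx: "M *v x = (\<rho> - k) *\<^sub>R x"
    by (simp add: matrix_vector_mult_add_rdistrib mat_mult_vector scalar_mult_eq_scaleR algebra_simps)
  have "complexify M *v (\<chi> i. of_real (x $ i)) = of_real (\<rho> - k) *s (\<chi> i. of_real (x $ i))"
  proof -
    have "(\<Sum>j\<in>UNIV. M $ i $ j * x $ j) = (\<rho> - k) * x $ i" for i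
      using arg_cong[OF Mx, of "\<lambda>y. y $ i"] by (simp add: matrix_vector_mult_def)
    then show ?thesis
      by (simp add: vec_eq_iff matrix_vector_mult_def flip: of_real_mult of_real_sum of_real_diff)
  qed
  moreover have "(\<chi> i. complex_of_real (x $ i)) \<noteq> 0"
    using x(2) by (simp add: vec_eq_iff)
  ultimately have "complex_of_real (\<rho> - k) \<in> eigenvalues M"
    unfolding eigenvalues_def by blast
  then have "\<rho> \<le> k"
    using Re_eigenvalue_le[of "of_real (\<rho> - k)" M] assms(2) by simp
  with x Mx show ?thesis
    using that by simp
qed

section \<open>Detectability of the closed loop\<close>

theorem theorem8:
  fixes A :: "real^'n^'n" and B :: "real^'m^'n" and F :: "real^'l^'n" and E :: "real^'n^'m"
    and s :: "real^'n" and r :: "real^'m" and \<gamma> :: "real^'l"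
    and p :: "real^'n" and K :: "real^'n^'m"
  assumes "0 \<le> F" and "0 \<le> E" and "0 \<le> \<gamma>"
    and "\<And>i. row i E \<noteq> 0"
    and "Metzler (A - \<bar>B\<bar> ** E)"
    and "transpose E *v \<bar>r\<bar> \<le> s"
    and "finite_minimax_value A B F E s r \<gamma> \<or> unique_minimal_solution A B F E s r \<gamma>"
    and "0 \<le> p" and "bellman_equation A B E s r p"
    and "\<And>i. \<exists>\<sigma>\<in>set_sign (r $ i + p \<bullet> column i B). row i K = \<sigma> *\<^sub>R row i E"
  shows "((\<forall>i. 0 < p $ i) \<and> spectral_abscissa (A - B ** K) \<noteq> 0 \<longrightarrow>
            detectable (rowvector s - rowvector r ** K :: real^'n^1) (A - B ** K) \<and>
            Hurwitz (A - B ** K)) \<and>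
         (spectral_abscissa (A - B ** K) = 0 \<longrightarrow>
            \<not> detectable (rowvector s - rowvector r ** K :: real^'n^1) (A - B ** K))"
proof -
  define M where "M = A - B ** K"
  define y where "y = r + transpose B *v p"
  define c where "c = s - transpose K *v r"
  \<comment> \<open>These properties hold for every admissible sign: where \<open>y $ i = 0\<close>,
    any value in \<open>[-1, 1]\<close> works, since both sides of the product identity
    vanish.\<close>
  have "\<exists>\<sigma>. \<bar>\<sigma>\<bar> \<le> 1 \<and> \<sigma> * y $ i = \<bar>y $ i\<bar> \<and> (\<forall>j. K $ i $ j = \<sigma> * E $ i $ j)" for i
  proof -
    have "y $ i = r $ i + p \<bullet> column i B"
      by (simp add: y_def matrix_vector_mult_def inner_vec_def transpose_def column_def mult.commute)
    with assms(10)[of i] obtain \<sigma> where "\<sigma> \<in> set_sign (y $ i)" "row i K = \<sigma> *\<^sub>R row i E"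
      by auto
    then show ?thesis
      by (intro exI[of _ \<sigma>]) (auto simp: set_sign_def row_def vec_eq_iff split: if_splits)
  qed
  then obtain \<sigma> where \<sigma>: "\<And>i. \<bar>\<sigma> i\<bar> \<le> 1" "\<And>i. \<sigma> i * y $ i = \<bar>y $ i\<bar>"
      and K: "\<And>i j. K $ i $ j = \<sigma> i * E $ i $ j"
    by metis
  have E: "0 \<le> E $ i $ j" for i j
    using assms(2) by (simp add: less_eq_vec_def)
  \<comment> \<open>The bound of \<open>K\<close> by \<open>E\<close> in modulus, in a form that
    serves twice: with \<open>a\<close> an entry of \<open>B\<close> for the Metzler property, and
    with \<open>a\<close> an entry of \<open>r\<close> for \<open>0 \<le> c\<close>.\<close>
  have K_le: "K $ i $ j * a \<le> E $ i $ j * \<bar>a\<bar>" for i j a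
  proof -
    have "\<sigma> i * a \<le> \<bar>\<sigma> i\<bar> * \<bar>a\<bar>"
      by (metis abs_ge_self abs_mult)
    also have "\<dots> \<le> \<bar>a\<bar>"
      using \<sigma>(1) by (simp add: mult_left_le_one_le)
    finally show ?thesis
      using mult_left_mono[OF _ E[of i j]] by (simp add: K mult.assoc mult.left_commute[of "\<sigma> i"])
  qed
  have "Metzler M"
    unfolding Metzler_def
  proof (intro allI impI)
    fix i j :: 'n
    assume "i \<noteq> j"
    have "(A - \<bar>B\<bar> ** E) $ i $ j \<le> M $ i $ j"
      using K_le[of _ j "B $ i $ _"]
      by (simp add: M_def matrix_matrix_mult_def abs_vec_def sum_mono mult.commute)
    with assms(5) \<open>i \<noteq> j\<close> show "0 \<le> M $ i $ j"
      unfolding Metzler_def by (meson order_trans)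
  qed
  \<comment> \<open>The identity \<open>\<sigma> i * y $ i = \<bar>y $ i\<bar>\<close> absorbs the
    absolute value into \<open>K\<close>, which makes the algebraic equation linear in
    \<open>p\<close>.\<close>
  have "transpose E *v \<bar>y\<bar> = transpose K *v y"
    by (simp add: vec_eq_iff matrix_vector_mult_def transpose_def abs_vec_def K mult.assoc
        mult.left_commute flip: \<sigma>(2))
  also have "\<dots> = transpose K *v r + transpose (B ** K) *v p"
    by (simp add: y_def matrix_vector_right_distrib matrix_transpose_mul matrix_vector_mul_assoc
        del: transpose_matrix_vector)
  finally have bellman: "s + transpose A *v p = transpose K *v r + transpose (B ** K) *v p"
    using assms(9) by (simp add: bellman_equation_def y_def)
  have "transpose M *v p = transpose A *v p - transpose (B ** K) *v p"
    by (simp add: M_def vec_eq_iff matrix_vector_mult_def transpose_def left_diff_distrib sum_subtractf)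
  then have "c + transpose M *v p = (s + transpose A *v p) - (transpose K *v r + transpose (B ** K) *v p)"
    by (simp add: c_def)
  then have Mp: "transpose M *v p = - c"
    using bellman by (simp add: add_eq_0_iff)
  have "0 \<le> c"
  proof -
    have "transpose K *v r \<le> transpose E *v \<bar>r\<bar>"
      using K_le by (simp add: less_eq_vec_def matrix_vector_mult_def transpose_def abs_vec_def sum_mono)
    also note assms(6)
    finally show ?thesis
      by (simp add: c_def)
  qed
  have "detectable (rowvector s - rowvector r ** K :: real^'n^1) M \<and> Hurwitz M"
    if "\<forall>i. 0 < p $ i" "spectral_abscissa M \<noteq> 0"
  proof -
    have "Re z \<le> 0" if "z \<in> eigenvalues M" for z
      using Metzler_Re_eigenvalue_nonpos[OF \<open>Metzler M\<close> _ _ that, of p] \<open>\<forall>i. 0 < p $ i\<close> \<open>0 \<le> c\<close>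
      by (simp add: Mp[simplified])
    with that(2) have "spectral_abscissa M < 0"
      using spectral_abscissa_eigenvalue[of M] by (metis order_le_less)
    then have "Hurwitz M"
      unfolding Hurwitz_def using Re_eigenvalue_le[of _ M] by fastforce
    \<comment> \<open>Every state is stable, so detectability holds whatever the output
      matrix.\<close>
    then show ?thesis
      by (simp add: detectable_def Hurwitz_imp_stable_state)
  qed
  moreover have "\<not> detectable (rowvector s - rowvector r ** K :: real^'n^1) M"
    if "spectral_abscissa M = 0"
  proof -
    let ?C = "rowvector s - rowvector r ** K :: real^'n^1"
    obtain x where x: "x \<noteq> 0" "M *v x = 0"
      using \<open>Metzler M\<close> \<open>spectral_abscissa M = 0\<close> by (rule Metzler_ex_kernel_vector)
    \<comment> \<open>The output has a single entry, which is the pairing with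
      \<open>c = - transpose M *v p\<close> and thus vanishes on the kernel of
      \<open>M\<close>.\<close>
    have "?C *v x = vec (c \<bullet> x)"
      by (simp add: vec_eq_iff matrix_vector_mult_def matrix_matrix_mult_def rowvector_def c_def
          inner_vec_def transpose_def mult.commute)
    also have "c \<bullet> x = - (p \<bullet> (M *v x))"
      using Mp by (simp add: dot_lmul_matrix[symmetric] transpose_matrix_vector minus_equation_iff[of _ c])
    finally have "?C *v x = 0"
      by (simp add: x(2) vec_eq_iff)
    moreover have motion: "free_motion M x (\<lambda>_. x)"
      by (simp add: free_motion_def x(2))
    ultimately have "unobservable_state ?C M x"
      unfolding unobservable_state_def by blast
    moreover have "\<not> stable_state M x"
      using motion x(1) by (auto simp: stable_state_def tendsto_const_iff)
    ultimately show ?thesis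
      by (auto simp: detectable_def)
  qed
  ultimately show ?thesis
    by (simp add: M_def)
qed

end
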